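(* Let $\precsim$ be a C-quasi-order on a group $G$. Then there is only one compatible C-relation on $G$ inducing it, namely the one given by the formula $C(x,y,z)\Leftrightarrow yz^{-1}\precnsim xz^{-1}$.
   Context: A quasi-order is a reflexive, transitive and total binary relation $\precsim$; $a\sim b$ means $a\precsim b\precsim a$, and $a\precnsim b$ means $a\precsim b$ and $a\nsim b$. A C-relation on a set is a ternary relation $C$ such that for all $x,y,z,w$: $C(x,y,z)\Rightarrow C(x,z,y)$; $C(x,y,z)\Rightarrow\neg C(y,x,z)$; $C(x,y,z)\Rightarrow C(w,y,z)\vee C(x,w,z)$; $x\neq y\Rightarrow C(x,y,y)$. On a group it is compatible if $C(x,y,z)$ implies $C(vxu,vyu,vzu)$ for all $x,y,z,u,v$. The quasi-order induced by a compatible C-relation $C$ on a group is $x\precsim y\Leftrightarrow\neg C(x,y,1)$. A C-quasi-order on a group is a quasi-order induced in this way by some compatible C-relation. *)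

theory Defs
  imports "HOL-Algebra.Group"
begin

text \<open>
  Relations on a set \<open>A\<close> are sets of tuples contained in the appropriate power of \<open>A\<close>, so that
  two relations on \<open>A\<close> are equal iff they hold of the same elements of \<open>A\<close>.
\<close>

text \<open>
  \<open>(a, b) \<in> r\<close> is read as \<open>a \<precsim> b\<close>. Since \<^const>\<open>total_on\<close> only compares distinct elements, it is
  reflexivity that makes any two elements of \<open>A\<close> comparable.
\<close>
definition quasi_order_on :: "'a set \<Rightarrow> 'a rel \<Rightarrow> bool" where
  "quasi_order_on A r \<longleftrightarrow> preorder_on A r \<and> total_on A r"

definition qo_equiv :: "'a rel \<Rightarrow> 'a \<Rightarrow> 'a \<Rightarrow> bool" where
  "qo_equiv r a b \<longleftrightarrow> (a, b) \<in> r \<and> (b, a) \<in> r"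

definition qo_strict :: "'a rel \<Rightarrow> 'a \<Rightarrow> 'a \<Rightarrow> bool" where
  "qo_strict r a b \<longleftrightarrow> (a, b) \<in> r \<and> \<not> qo_equiv r a b"

definition C_relation_on :: "'a set \<Rightarrow> ('a \<times> 'a \<times> 'a) set \<Rightarrow> bool" where
  "C_relation_on A C \<longleftrightarrow>
     C \<subseteq> A \<times> A \<times> A \<and>
     (\<forall>x\<in>A. \<forall>y\<in>A. \<forall>z\<in>A. (x, y, z) \<in> C \<longrightarrow> (x, z, y) \<in> C) \<and>
     (\<forall>x\<in>A. \<forall>y\<in>A. \<forall>z\<in>A. (x, y, z) \<in> C \<longrightarrow> (y, x, z) \<notin> C) \<and>
     (\<forall>x\<in>A. \<forall>y\<in>A. \<forall>z\<in>A. \<forall>w\<in>A. (x, y, z) \<in> C \<longrightarrow> (w, y, z) \<in> C \<or> (x, w, z) \<in> C) \<and>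
     (\<forall>x\<in>A. \<forall>y\<in>A. x \<noteq> y \<longrightarrow> (x, y, y) \<in> C)"

definition compatible :: "('a, 'b) monoid_scheme \<Rightarrow> ('a \<times> 'a \<times> 'a) set \<Rightarrow> bool" where
  "compatible G C \<longleftrightarrow>
     (\<forall>x\<in>carrier G. \<forall>y\<in>carrier G. \<forall>z\<in>carrier G. \<forall>u\<in>carrier G. \<forall>v\<in>carrier G.
        (x, y, z) \<in> C \<longrightarrow>
        (v \<otimes>\<^bsub>G\<^esub> x \<otimes>\<^bsub>G\<^esub> u, v \<otimes>\<^bsub>G\<^esub> y \<otimes>\<^bsub>G\<^esub> u, v \<otimes>\<^bsub>G\<^esub> z \<otimes>\<^bsub>G\<^esub> u) \<in> C)"

definition compatible_C_relation :: "('a, 'b) monoid_scheme \<Rightarrow> ('a \<times> 'a \<times> 'a) set \<Rightarrow> bool" where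
  "compatible_C_relation G C \<longleftrightarrow> C_relation_on (carrier G) C \<and> compatible G C"

definition induced_quasi_order :: "('a, 'b) monoid_scheme \<Rightarrow> ('a \<times> 'a \<times> 'a) set \<Rightarrow> 'a rel" where
  "induced_quasi_order G C =
     {(x, y). x \<in> carrier G \<and> y \<in> carrier G \<and> (x, y, \<one>\<^bsub>G\<^esub>) \<notin> C}"

definition C_quasi_order :: "('a, 'b) monoid_scheme \<Rightarrow> 'a rel \<Rightarrow> bool" where
  "C_quasi_order G r \<longleftrightarrow>
     quasi_order_on (carrier G) r \<and>
     (\<exists>C. compatible_C_relation G C \<and> r = induced_quasi_order G C)"

end

theory Submission
  imports Defs
begin

text \<open>A compatible C-relation is determined by its triples with third entry
  \<open>\<one>\<close>: right translation by \<open>inv z\<close> turns \<open>(x, y, z)\<close>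
  into \<open>(x \<otimes> inv z, y \<otimes> inv z, \<one>)\<close>, and
  \<open>compatible_translate_iff\<close> makes this an equivalence. On such triples C is the strict
  part of the induced quasi-order with the arguments swapped (\<open>qo_strict_induced_iff\<close>).
  So C can be recovered from \<open>r\<close>, which gives both the formula and uniqueness;
  existence is part of being a C-quasi-order.\<close>

lemma (in group) compatible_translate_iff:
  assumes "compatible G C" "x \<in> carrier G" "y \<in> carrier G" "z \<in> carrier G" "u \<in> carrier G"
  shows "(x \<otimes> u, y \<otimes> u, z \<otimes> u) \<in> C \<longleftrightarrow> (x, y, z) \<in> C"
proof -
  \<comment> \<open>Compatibility with left factor \<open>\<one>\<close>. It is only an implication;
    translating back by \<open>inv u\<close> gives the converse.\<close>
  have translate: "(a \<otimes> c, b \<otimes> c, d \<otimes> c) \<in> C"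
    if "(a, b, d) \<in> C" "a \<in> carrier G" "b \<in> carrier G" "d \<in> carrier G" "c \<in> carrier G"
    for a b c d
    using assms(1) that unfolding compatible_def by (metis l_one one_closed)
  have cancel: "a \<otimes> u \<otimes> inv u = a" if "a \<in> carrier G" for a
    using that assms(5) by (simp add: m_assoc)
  show ?thesis
    using translate[of x y z u] translate[of "x \<otimes> u" "y \<otimes> u" "z \<otimes> u" "inv u"] assms cancel
    by auto
qed

text \<open>Strictness unfolds to \<open>(a, b, \<one>) \<in> C\<close> together with
  \<open>(b, a, \<one>) \<notin> C\<close>, and the second follows from the first by the asymmetry
  axiom of C-relations.\<close>

lemma qo_strict_induced_iff:
  assumes "C_relation_on (carrier G) C" "\<one>\<^bsub>G\<^esub> \<in> carrier G" "a \<in> carrier G" "b \<in> carrier G"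
  shows "qo_strict (induced_quasi_order G C) b a \<longleftrightarrow> (a, b, \<one>\<^bsub>G\<^esub>) \<in> C"
proof -
  have "(a, b, \<one>\<^bsub>G\<^esub>) \<in> C \<longrightarrow> (b, a, \<one>\<^bsub>G\<^esub>) \<notin> C"
    using assms unfolding C_relation_on_def by blast
  then show ?thesis
    using assms(3,4) unfolding qo_strict_def qo_equiv_def induced_quasi_order_def by auto
qed

lemma (in group) compatible_C_relation_iff:
  assumes "compatible_C_relation G C" "x \<in> carrier G" "y \<in> carrier G" "z \<in> carrier G"
  shows "(x, y, z) \<in> C \<longleftrightarrow> qo_strict (induced_quasi_order G C) (y \<otimes> inv z) (x \<otimes> inv z)"
  using assms compatible_translate_iff[of C x y z "inv z"]
    qo_strict_induced_iff[of G C "x \<otimes> inv z" "y \<otimes> inv z"]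
  by (simp add: compatible_C_relation_def)

theorem proposition2p4:
  fixes G :: "('a, 'b) monoid_scheme" (structure) and r :: "'a rel"
  assumes "group G" and "C_quasi_order G r"
  shows "(\<exists>!C. compatible_C_relation G C \<and> induced_quasi_order G C = r) \<and>
         (\<forall>C. compatible_C_relation G C \<and> induced_quasi_order G C = r \<longrightarrow>
            (\<forall>x\<in>carrier G. \<forall>y\<in>carrier G. \<forall>z\<in>carrier G.
               (x, y, z) \<in> C \<longleftrightarrow> qo_strict r (y \<otimes> inv z) (x \<otimes> inv z)))"
proof -
  interpret group G by fact
  let ?induces = "\<lambda>C. compatible_C_relation G C \<and> induced_quasi_order G C = r"
  have formula: "(x, y, z) \<in> C \<longleftrightarrow> qo_strict r (y \<otimes> inv z) (x \<otimes> inv z)"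
    if "?induces C" "x \<in> carrier G" "y \<in> carrier G" "z \<in> carrier G" for C x y z
    using that compatible_C_relation_iff by blast
  \<comment> \<open>The formula only speaks of triples from the carrier, so the inclusion of C in
    the cube of the carrier is what turns it into a comparison of sets.\<close>
  have subset: "C \<subseteq> D" if "?induces C" "?induces D" for C D
  proof (rule subrelI)
    fix x p
    assume "(x, p) \<in> C"
    moreover have "C \<subseteq> carrier G \<times> carrier G \<times> carrier G"
      using that(1) by (simp add: compatible_C_relation_def C_relation_on_def)
    ultimately show "(x, p) \<in> D"
      using formula[OF that(1)] formula[OF that(2)] by (cases p) blast
  qed
  have "\<exists>C. ?induces C"
    using assms(2) unfolding C_quasi_order_def by blast
  \<comment> \<open>\<open>subset\<close> is symmetric in its two hypotheses, so using it both ways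
    yields equality.\<close>
  then have "\<exists>!C. ?induces C"
    using subset subset_antisym by (intro ex_ex1I) blast+
  with formula show ?thesis
    by blast
qed

end
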